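(* Let $X$ be any topological space and let $F$ be a continuous $\mathbf I\mathbb R_+^\star$-valuation on $X$. For $h\in\mathcal L^{\mathbf I\mathbb R_+^\star}X$, write $F(h)=[F^-(h),F^+(h)]$. Then, for every $h\in\mathcal L^{\mathbf I\mathbb R_+^\star}X$, $F^-(h)$ only depends on $h^-$, not on $h^+$. Moreover, there is a unique continuous valuation $\nu_F$ on $X$ such that, for every $h\in\mathcal L^{\mathbf I\mathbb R_+^\star}X$, $$F^-(h)=\int_X h^-\,d\nu_F.$$
   Context: $\overline{\mathbb R}_+=[0,+\infty]$ with its Scott topology. $\mathbf I\mathbb R_+^\star$ is the dcpo of closed intervals $[a,b]$ with $0\le a\le b\le+\infty$, ordered by reverse inclusion, with its Scott topology. It carries $0=[0,0]$, $1=[1,1]$, $[a,b]+[c,d]=[a+c,b+d]$, $[a,b]\times[c,d]=[a\cdot_\ell c,\ b\cdot_r d]$, where $\cdot_\ell$ and $\cdot_r$ are the usual product except that $0\cdot_\ell(+\infty)=(+\infty)\cdot_\ell 0=0$ and $0\cdot_r(+\infty)=(+\infty)\cdot_r 0=+\infty$. $\mathcal L^{\mathbf I\mathbb R_+^\star}X$ is the dcpo of continuous maps $h:X\to\mathbf I\mathbb R_+^\star$, ordered pointwise, with pointwise $+$ and $\times$; write $h(x)=[h^-(x),h^+(x)]$. A continuous $\mathbf I\mathbb R_+^\star$-valuation on $X$ is a Scott-continuous map $F:\mathcal L^{\mathbf I\mathbb R_+^\star}X\to\mathbf I\mathbb R_+^\star$ with $F(\mathbf a\times h)=\mathbf a\times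 F(h)$ and $F(h+h')=F(h)+F(h')$ for all $\mathbf a\in\mathbf I\mathbb R_+^\star$ and all $h,h'$. A continuous valuation on $X$ is a Scott-continuous map $\nu:\mathcal O X\to\overline{\mathbb R}_+$ on the lattice of open sets with $\nu(\emptyset)=0$ and $\nu(U\cup V)+\nu(U\cap V)=\nu(U)+\nu(V)$. For a lower semicontinuous $f:X\to\overline{\mathbb R}_+$, $\int_X f\,d\nu=\int_0^{+\infty}\nu(f^{-1}(]t,+\infty]))\,dt$ (Riemann integral). *)

theory Defs
  imports "HOL-Analysis.Analysis" "HOL-Library.Interval"
begin

section \<open>Scott topology and Scott-continuous maps\<close>

text \<open>A poset is given by a carrier \<open>A\<close> and an order relation \<open>le\<close> on it.\<close>

definition directed_in :: "'a set \<Rightarrow> ('a \<Rightarrow> 'a \<Rightarrow> bool) \<Rightarrow> 'a set \<Rightarrow> bool" where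
  "directed_in A le D \<longleftrightarrow>
     D \<subseteq> A \<and> D \<noteq> {} \<and> (\<forall>x\<in>D. \<forall>y\<in>D. \<exists>z\<in>D. le x z \<and> le y z)"

definition is_sup_in :: "'a set \<Rightarrow> ('a \<Rightarrow> 'a \<Rightarrow> bool) \<Rightarrow> 'a set \<Rightarrow> 'a \<Rightarrow> bool" where
  "is_sup_in A le D s \<longleftrightarrow>
     s \<in> A \<and> (\<forall>x\<in>D. le x s) \<and> (\<forall>u\<in>A. (\<forall>x\<in>D. le x u) \<longrightarrow> le s u)"

definition scott_open :: "'a set \<Rightarrow> ('a \<Rightarrow> 'a \<Rightarrow> bool) \<Rightarrow> 'a set \<Rightarrow> bool" where
  "scott_open A le U \<longleftrightarrow>
     U \<subseteq> A \<and> (\<forall>x\<in>U. \<forall>y\<in>A. le x y \<longrightarrow> y \<in> U) \<and>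
     (\<forall>D s. directed_in A le D \<longrightarrow> is_sup_in A le D s \<longrightarrow> s \<in> U \<longrightarrow> D \<inter> U \<noteq> {})"

definition scott_topology :: "'a set \<Rightarrow> ('a \<Rightarrow> 'a \<Rightarrow> bool) \<Rightarrow> 'a topology" where
  "scott_topology A le = topology (scott_open A le)"

lemma scott_openD:
  assumes "scott_open A le U"
  shows "U \<subseteq> A" "\<And>x y. x \<in> U \<Longrightarrow> y \<in> A \<Longrightarrow> le x y \<Longrightarrow> y \<in> U"
    "\<And>D s. directed_in A le D \<Longrightarrow> is_sup_in A le D s \<Longrightarrow> s \<in> U \<Longrightarrow> \<exists>x\<in>D. x \<in> U"
proof -
  show "U \<subseteq> A" using assms by (simp add: scott_open_def)
  show "y \<in> U" if "x \<in> U" "y \<in> A" "le x y" for x y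
    using assms that by (auto simp: scott_open_def)
  show "\<exists>x\<in>D. x \<in> U" if "directed_in A le D" "is_sup_in A le D s" "s \<in> U" for D s
  proof -
    have "D \<inter> U \<noteq> {}" using assms that unfolding scott_open_def by simp
    then show ?thesis by auto
  qed
qed

lemma scott_openI:
  assumes "U \<subseteq> A" "\<And>x y. x \<in> U \<Longrightarrow> y \<in> A \<Longrightarrow> le x y \<Longrightarrow> y \<in> U"
    "\<And>D s. directed_in A le D \<Longrightarrow> is_sup_in A le D s \<Longrightarrow> s \<in> U \<Longrightarrow> \<exists>x\<in>D. x \<in> U"
  shows "scott_open A le U"
  unfolding scott_open_def
proof (intro conjI ballI allI impI)
  fix D s assume "directed_in A le D" "is_sup_in A le D s" "s \<in> U"
  from assms(3)[OF this] show "D \<inter> U \<noteq> {}" by auto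
qed (use assms(1,2) in auto)

lemma istopology_scott_open: "istopology (scott_open A le)"
  unfolding istopology_def
proof (intro conjI allI impI)
  fix S T assume S: "scott_open A le S" and T: "scott_open A le T"
  show "scott_open A le (S \<inter> T)"
  proof (rule scott_openI)
    show "S \<inter> T \<subseteq> A" using scott_openD(1)[OF S] by auto
  next
    fix x y assume "x \<in> S \<inter> T" "y \<in> A" "le x y"
    then show "y \<in> S \<inter> T"
      using scott_openD(2)[OF S, of x y] scott_openD(2)[OF T, of x y] by simp
  next
    fix D s assume D: "directed_in A le D" and s: "is_sup_in A le D s" "s \<in> S \<inter> T"
    obtain x where x: "x \<in> D" "x \<in> S" using scott_openD(3)[OF S D s(1)] s by auto
    obtain y where y: "y \<in> D" "y \<in> T" using scott_openD(3)[OF T D s(1)] s by auto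
    obtain z where z: "z \<in> D" "le x z" "le y z"
      using D x y unfolding directed_in_def by meson
    then have "z \<in> A" using D by (auto simp: directed_in_def)
    then have "z \<in> S" "z \<in> T"
      using scott_openD(2)[OF S x(2)] scott_openD(2)[OF T y(2)] z by auto
    then show "\<exists>x\<in>D. x \<in> S \<inter> T" using z by auto
  qed
next
  fix K assume K: "\<forall>S\<in>K. scott_open A le S"
  show "scott_open A le (\<Union>K)"
  proof (rule scott_openI)
    show "\<Union>K \<subseteq> A" using K by (auto simp: scott_open_def)
  next
    fix x y assume "x \<in> \<Union>K" and y: "y \<in> A" "le x y"
    then obtain S where S: "S \<in> K" "x \<in> S" by auto
    then have "y \<in> S" using scott_openD(2)[of A le S x y] K y by simp
    then show "y \<in> \<Union>K" using S by auto
  next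
    fix D s assume D: "directed_in A le D" "is_sup_in A le D s" and "s \<in> \<Union>K"
    then obtain S where S: "S \<in> K" "s \<in> S" by auto
    then have "\<exists>x\<in>D. x \<in> S" using scott_openD(3)[of A le S D s] K D by simp
    then show "\<exists>x\<in>D. x \<in> \<Union>K" using S by auto
  qed
qed

lemma openin_scott_topology: "openin (scott_topology A le) U \<longleftrightarrow> scott_open A le U"
  by (simp add: scott_topology_def istopology_scott_open topology_inverse')

lemma topspace_scott_topology: "topspace (scott_topology A le) = A"
proof
  have "scott_open A le A"
    by (auto simp: scott_open_def directed_in_def)
  then show "A \<subseteq> topspace (scott_topology A le)"
    by (simp add: openin_scott_topology openin_subset)
  show "topspace (scott_topology A le) \<subseteq> A"
    by (auto simp: topspace_def openin_scott_topology scott_open_def)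
qed

definition scott_continuous ::
  "'a set \<Rightarrow> ('a \<Rightarrow> 'a \<Rightarrow> bool) \<Rightarrow> 'b set \<Rightarrow> ('b \<Rightarrow> 'b \<Rightarrow> bool) \<Rightarrow> ('a \<Rightarrow> 'b) \<Rightarrow> bool" where
  "scott_continuous A leA B leB f \<longleftrightarrow>
     f \<in> A \<rightarrow> B \<and>
     (\<forall>x\<in>A. \<forall>y\<in>A. leA x y \<longrightarrow> leB (f x) (f y)) \<and>
     (\<forall>D s. directed_in A leA D \<longrightarrow> is_sup_in A leA D s \<longrightarrow> is_sup_in B leB (f ` D) (f s))"

text \<open>This agrees with continuity for the Scott topologies.\<close>

lemma scott_continuous_iff_continuous_map:
  assumes reflB: "\<And>x. x \<in> B \<Longrightarrow> leB x x"
    and transB: "\<And>x y z. x \<in> B \<Longrightarrow> y \<in> B \<Longrightarrow> z \<in> B \<Longrightarrow> leB x y \<Longrightarrow> leB y z \<Longrightarrow> leB x z"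
  shows "scott_continuous A leA B leB f \<longleftrightarrow>
         continuous_map (scott_topology A leA) (scott_topology B leB) f"
proof
  assume f: "scott_continuous A leA B leB f"
  then have fB: "f x \<in> B" if "x \<in> A" for x
    using that by (auto simp: scott_continuous_def)
  have mono: "leB (f x) (f y)" if "x \<in> A" "y \<in> A" "leA x y" for x y
    using f that by (auto simp: scott_continuous_def)
  have sup: "is_sup_in B leB (f ` D) (f s)" if "directed_in A leA D" "is_sup_in A leA D s" for D s
    using f that by (simp add: scott_continuous_def)
  show "continuous_map (scott_topology A leA) (scott_topology B leB) f"
    unfolding continuous_map_def topspace_scott_topology openin_scott_topology
  proof (intro conjI allI impI)
    show "f \<in> A \<rightarrow> B" using fB by simp
    fix U assume U: "scott_open B leB U"
    show "scott_open A leA {x \<in> A. f x \<in> U}"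
    proof (rule scott_openI)
      show "{x \<in> A. f x \<in> U} \<subseteq> A" by simp
    next
      fix x y assume "x \<in> {x \<in> A. f x \<in> U}" "y \<in> A" "leA x y"
      then show "y \<in> {x \<in> A. f x \<in> U}"
        using scott_openD(2)[OF U, of "f x" "f y"] fB mono by simp
    next
      fix D s assume D: "directed_in A leA D" and s: "is_sup_in A leA D s" "s \<in> {x \<in> A. f x \<in> U}"
      have DA: "x \<in> A" if "x \<in> D" for x using D that by (auto simp: directed_in_def)
      have "directed_in B leB (f ` D)"
        unfolding directed_in_def
      proof (intro conjI ballI)
        show "f ` D \<subseteq> B" using fB DA by auto
        show "f ` D \<noteq> {}" using D by (simp add: directed_in_def)
        fix u v assume "u \<in> f ` D" "v \<in> f ` D"
        then obtain x y where xy: "x \<in> D" "y \<in> D" "u = f x" "v = f y" by auto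
        with D obtain z where z: "z \<in> D" "leA x z" "leA y z"
          unfolding directed_in_def by meson
        then have "leB u (f z)" "leB v (f z)" using xy DA mono by simp_all
        then show "\<exists>w\<in>f ` D. leB u w \<and> leB v w" using z by auto
      qed
      from scott_openD(3)[OF U this sup[OF D s(1)]] s
      show "\<exists>x\<in>D. x \<in> {x \<in> A. f x \<in> U}" using DA by auto
    qed
  qed
next
  assume "continuous_map (scott_topology A leA) (scott_topology B leB) f"
  then have fB: "\<And>x. x \<in> A \<Longrightarrow> f x \<in> B"
    and op: "\<And>U. scott_open B leB U \<Longrightarrow> scott_open A leA {x \<in> A. f x \<in> U}"
    by (auto simp: continuous_map_def topspace_scott_topology openin_scott_topology)
  have opn: "scott_open B leB {v \<in> B. \<not> leB v u}" if u: "u \<in> B" for u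
  proof (rule scott_openI)
    show "{v \<in> B. \<not> leB v u} \<subseteq> B" by simp
  next
    fix x y assume "x \<in> {v \<in> B. \<not> leB v u}" "y \<in> B" "leB x y"
    then show "y \<in> {v \<in> B. \<not> leB v u}" using transB[of x y u] u by auto
  next
    fix D s assume D: "directed_in B leB D" and s: "is_sup_in B leB D s" "s \<in> {v \<in> B. \<not> leB v u}"
    from s u have "\<not> (\<forall>x\<in>D. leB x u)" by (auto simp: is_sup_in_def)
    then show "\<exists>x\<in>D. x \<in> {v \<in> B. \<not> leB v u}" using D by (auto simp: directed_in_def)
  qed
  have mono: "leB (f x) (f y)" if "x \<in> A" "y \<in> A" "leA x y" for x y
    using scott_openD(2)[OF op[OF opn[OF fB[OF that(2)]]], of x y] that fB reflB by auto
  show "scott_continuous A leA B leB f"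
    unfolding scott_continuous_def
  proof (intro conjI ballI allI impI)
    show "f \<in> A \<rightarrow> B" using fB by simp
    show "leB (f x) (f y)" if "x \<in> A" "y \<in> A" "leA x y" for x y using mono that by simp
    fix D s assume D: "directed_in A leA D" and s: "is_sup_in A leA D s"
    have DA: "x \<in> A" if "x \<in> D" for x using D that by (auto simp: directed_in_def)
    show "is_sup_in B leB (f ` D) (f s)"
      unfolding is_sup_in_def
    proof (intro conjI ballI impI)
      show "f s \<in> B" using s fB by (simp add: is_sup_in_def)
      show "leB v (f s)" if "v \<in> f ` D" for v
        using that DA s mono by (auto simp: is_sup_in_def)
      show "leB (f s) u" if u: "u \<in> B" "\<forall>v\<in>f ` D. leB v u" for u
      proof (rule ccontr)
        assume "\<not> leB (f s) u"
        then have "s \<in> {x \<in> A. f x \<in> {v \<in> B. \<not> leB v u}}"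
          using s fB by (auto simp: is_sup_in_def)
        from scott_openD(3)[OF op[OF opn[OF u(1)]] D s this] show False using u by auto
      qed
    qed
  qed
qed

section \<open>The interval domain\<close>

type_synonym ivl = "ennreal interval"

text \<open>
  The library order on \<^typ>\<open>'a interval\<close> is inclusion; the domain is ordered by
  reverse inclusion. The library provides \<open>0\<close>, \<open>1\<close> and \<open>+\<close> as required; the library's
  \<open>*\<close> on intervals is not the intended product and is not used.
\<close>

definition ivl_le :: "ivl \<Rightarrow> ivl \<Rightarrow> bool" (infix \<open>\<sqsubseteq>\<^sub>I\<close> 50) where
  "a \<sqsubseteq>\<^sub>I b \<longleftrightarrow> set_of b \<subseteq> set_of a"

text \<open>
  On \<^typ>\<open>ennreal\<close> the library product satisfies \<open>0 * \<infinity> = \<infinity> * 0 = 0\<close>,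
  so it is the product used for lower end points.
\<close>

definition mult_r :: "ennreal \<Rightarrow> ennreal \<Rightarrow> ennreal" (infixl \<open>\<cdot>\<^sub>r\<close> 70) where
  "x \<cdot>\<^sub>r y = (if x = 0 \<and> y = \<infinity> \<or> x = \<infinity> \<and> y = 0 then \<infinity> else x * y)"

definition ivl_mult :: "ivl \<Rightarrow> ivl \<Rightarrow> ivl" (infixl \<open>\<otimes>\<^sub>I\<close> 70) where
  "a \<otimes>\<^sub>I b = Interval (lower a * lower b, upper a \<cdot>\<^sub>r upper b)"

lemma ivl_mult_le: "lower a * lower b \<le> upper a \<cdot>\<^sub>r upper b" for a b :: ivl
  by (auto simp: mult_r_def intro: mult_mono)

lemma lower_ivl_mult: "lower (a \<otimes>\<^sub>I b) = lower a * lower b"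
  using ivl_mult_le[of a b] by (simp add: ivl_mult_def lower.rep_eq Interval_inverse)

lemma upper_ivl_mult: "upper (a \<otimes>\<^sub>I b) = upper a \<cdot>\<^sub>r upper b"
  using ivl_mult_le[of a b] by (simp add: ivl_mult_def upper.rep_eq Interval_inverse)

section \<open>Interval-valued valuations\<close>

text \<open>
  Maps on a topological space \<open>X\<close> are represented by functions that are \<open>undefined\<close> outside
  \<open>topspace X\<close>, so that equality of functions is equality of maps on \<open>X\<close>.
\<close>

definition LI :: "'a topology \<Rightarrow> ('a \<Rightarrow> ivl) set" where
  "LI X = {h \<in> extensional (topspace X). continuous_map X (scott_topology UNIV (\<sqsubseteq>\<^sub>I)) h}"

definition LI_le :: "'a topology \<Rightarrow> ('a \<Rightarrow> ivl) \<Rightarrow> ('a \<Rightarrow> ivl) \<Rightarrow> bool" where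
  "LI_le X h h' \<longleftrightarrow> (\<forall>x\<in>topspace X. h x \<sqsubseteq>\<^sub>I h' x)"

definition continuous_ivl_valuation :: "'a topology \<Rightarrow> (('a \<Rightarrow> ivl) \<Rightarrow> ivl) \<Rightarrow> bool" where
  "continuous_ivl_valuation X F \<longleftrightarrow>
     scott_continuous (LI X) (LI_le X) UNIV (\<sqsubseteq>\<^sub>I) F \<and>
     (\<forall>a. \<forall>h\<in>LI X. F (\<lambda>x\<in>topspace X. a \<otimes>\<^sub>I h x) = a \<otimes>\<^sub>I F h) \<and>
     (\<forall>h\<in>LI X. \<forall>h'\<in>LI X. F (\<lambda>x\<in>topspace X. h x + h' x) = F h + F h')"

section \<open>Continuous valuations and integration\<close>

text \<open>As above, a map on the open sets of \<open>X\<close> is \<open>undefined\<close> on other sets.\<close>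

definition continuous_valuation :: "'a topology \<Rightarrow> ('a set \<Rightarrow> ennreal) \<Rightarrow> bool" where
  "continuous_valuation X \<nu> \<longleftrightarrow>
     \<nu> \<in> extensional {U. openin X U} \<and>
     scott_continuous {U. openin X U} (\<subseteq>) UNIV (\<le>) \<nu> \<and>
     \<nu> {} = 0 \<and>
     (\<forall>U V. openin X U \<longrightarrow> openin X V \<longrightarrow> \<nu> (U \<union> V) + \<nu> (U \<inter> V) = \<nu> U + \<nu> V)"

text \<open>
  The improper Riemann integral over \<open>[0, +\<infinity>[\<close> of an antitone function with values in
  \<open>[0, +\<infinity>]\<close>, as the supremum of the lower Darboux sums over all subdivisions
  \<open>0 = t\<^sub>0 \<le> \<dots> \<le> t\<^sub>n\<close>. Infinite values and unboundedness near \<open>0\<close> are allowed.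
\<close>

definition riemann_integral :: "(real \<Rightarrow> ennreal) \<Rightarrow> ennreal" where
  "riemann_integral g =
     (SUP (n, t) \<in> {(n::nat, t::nat \<Rightarrow> real). t 0 = 0 \<and> (\<forall>i<n. t i \<le> t (Suc i))}.
        \<Sum>i<n. ennreal (t (Suc i) - t i) * (INF s\<in>{t i..t (Suc i)}. g s))"

text \<open>For antitone functions it agrees with the Lebesgue integral.\<close>

lemma riemann_integral_eq_nn_integral:
  fixes g :: "real \<Rightarrow> ennreal"
  assumes g: "antimono_on {0..} g"
  shows "riemann_integral g = (\<integral>\<^sup>+t\<in>{0..}. g t \<partial>lborel)"
proof (rule antisym)
  have anti: "g y \<le> g x" if "0 \<le> x" "x \<le> y" for x y
    using g that by (auto simp: monotone_on_def)
  have INF: "(INF s\<in>{a..b}. g s) = g b" if "0 \<le> a" "a \<le> b" for a b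
    using that by (intro antisym INF_greatest INF_lower anti) auto
  have meas: "(\<lambda>t. g t * indicator {0<..} t) \<in> borel_measurable borel"
  proof (rule borel_measurableI_greater)
    fix y
    have "is_interval {t. y < g t * indicator {0<..} t}"
      unfolding is_interval_1
    proof (intro ballI allI impI)
      fix a b x assume "a \<in> {t. y < g t * indicator {0<..} t}"
        and b: "b \<in> {t. y < g t * indicator {0<..} t}" and "a \<le> x \<and> x \<le> b"
      then have "0 < a" "a \<le> x" "x \<le> b" by (cases "0 < a"; auto)+
      then have "0 < x" "x \<le> b" "g b \<le> g x" by (auto intro: anti)
      then show "x \<in> {t. y < g t * indicator {0<..} t}" using b by (auto simp: indicator_def)
    qed
    then show "{x \<in> space borel. y < g x * indicator {0<..} x} \<in> sets borel"
      by (simp add: real_interval_borel_measurable)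
  qed
  have measI: "(\<lambda>t. g t * indicator {a..<b} t) \<in> borel_measurable borel" if "0 < a" for a b
  proof -
    have "(\<lambda>t. g t * indicator {a..<b} t) =
          (\<lambda>t. (g t * indicator {0<..} t) * indicator {a..<b} t)"
      using that by (auto simp: indicator_def fun_eq_iff)
    then show ?thesis using meas by simp
  qed
  have eq0: "(\<integral>\<^sup>+t\<in>{0..}. g t \<partial>lborel) = (\<integral>\<^sup>+t\<in>{0<..}. g t \<partial>lborel)"
  proof (rule nn_integral_cong_AE)
    show "AE t in lborel. g t * indicator {0..} t = g t * indicator {0<..} t"
      using AE_lborel_singleton[of "0::real"]
      by eventually_elim (auto simp: indicator_def)
  qed
  show "riemann_integral g \<le> (\<integral>\<^sup>+t\<in>{0..}. g t \<partial>lborel)"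
    unfolding riemann_integral_def
  proof (rule SUP_least, clarify)
    fix n :: nat and t :: "nat \<Rightarrow> real"
    assume t0: "t 0 = 0" and t: "\<forall>i<n. t i \<le> t (Suc i)"
    have "(\<Sum>i<m. ennreal (t (Suc i) - t i) * (INF s\<in>{t i..t (Suc i)}. g s))
          \<le> (\<integral>\<^sup>+x. g x * indicator {0<..} x * indicator {0<..<t m} x \<partial>lborel) \<and> 0 \<le> t m"
      if "m \<le> n" for m
      using that
    proof (induction m)
      case 0
      then show ?case by (simp add: t0)
    next
      case (Suc m)
      let ?G = "\<lambda>x. g x * indicator {0<..} x"
      have IH: "(\<Sum>i<m. ennreal (t (Suc i) - t i) * (INF s\<in>{t i..t (Suc i)}. g s))
          \<le> (\<integral>\<^sup>+x. ?G x * indicator {0<..<t m} x \<partial>lborel)" and tm: "0 \<le> t m" "t m \<le> t (Suc m)"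
        using Suc t by auto
      have "ennreal (t (Suc m) - t m) * (INF s\<in>{t m..t (Suc m)}. g s)
            = (\<integral>\<^sup>+x. g (t (Suc m)) * indicator {t m<..<t (Suc m)} x \<partial>lborel)"
        using tm by (simp add: INF nn_integral_cmult_indicator mult.commute)
      also have "\<dots> \<le> (\<integral>\<^sup>+x. ?G x * indicator {t m<..<t (Suc m)} x \<partial>lborel)"
        using tm by (intro nn_integral_mono) (auto simp: indicator_def intro!: anti)
      finally have "(\<Sum>i<Suc m. ennreal (t (Suc i) - t i) * (INF s\<in>{t i..t (Suc i)}. g s))
          \<le> (\<integral>\<^sup>+x. ?G x * indicator {0<..<t m} x \<partial>lborel)
             + (\<integral>\<^sup>+x. ?G x * indicator {t m<..<t (Suc m)} x \<partial>lborel)"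
        using IH by (simp add: add_mono)
      also have "\<dots> = (\<integral>\<^sup>+x. ?G x * indicator {0<..<t m} x
                        + ?G x * indicator {t m<..<t (Suc m)} x \<partial>lborel)"
        using meas by (intro nn_integral_add[symmetric]) auto
      also have "\<dots> \<le> (\<integral>\<^sup>+x. ?G x * indicator {0<..<t (Suc m)} x \<partial>lborel)"
        using tm by (intro nn_integral_mono) (auto simp: indicator_def)
      finally show ?case using tm by auto
    qed
    from this[of n] have "(\<Sum>i<n. ennreal (t (Suc i) - t i) * (INF s\<in>{t i..t (Suc i)}. g s))
          \<le> (\<integral>\<^sup>+x. g x * indicator {0<..} x * indicator {0<..<t n} x \<partial>lborel)" by simp
    also have "\<dots> \<le> (\<integral>\<^sup>+t\<in>{0..}. g t \<partial>lborel)"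
      by (intro nn_integral_mono) (auto simp: indicator_def)
    finally show "(\<Sum>i<n. ennreal (t (Suc i) - t i) * (INF s\<in>{t i..t (Suc i)}. g s))
        \<le> (\<integral>\<^sup>+t\<in>{0..}. g t \<partial>lborel)" .
  qed
  show "(\<integral>\<^sup>+t\<in>{0..}. g t \<partial>lborel) \<le> riemann_integral g"
  proof -
    define G where "G m t = g t * indicator {1 / real (Suc m)..<real (Suc m)} t" for m t
    have "(\<integral>\<^sup>+t\<in>{0<..}. g t \<partial>lborel) \<le> (\<integral>\<^sup>+t. (SUP m. G m t) \<partial>lborel)"
    proof (rule nn_integral_mono)
      fix t :: real
      show "g t * indicator {0<..} t \<le> (SUP m. G m t)"
      proof (cases "0 < t")
        case True
        obtain p q where p: "t < real p" and q: "inverse (real (Suc q)) < t"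
          using reals_Archimedean2[of t] reals_Archimedean[OF True] by blast
        have "1 / real (Suc (p + q)) \<le> inverse (real (Suc q))"
          by (simp add: field_simps)
        then have "G (p + q) t = g t" using p q by (auto simp: G_def indicator_def)
        then show ?thesis using True by (intro SUP_upper2[of "p + q"]) auto
      qed auto
    qed
    also have "\<dots> = (SUP m. \<integral>\<^sup>+t. G m t \<partial>lborel)"
    proof (rule nn_integral_monotone_convergence_SUP)
      show "incseq G"
      proof (rule incseq_SucI, rule le_funI)
        fix m t
        have "1 / real (Suc (Suc m)) \<le> 1 / real (Suc m)" by (simp add: field_simps)
        then show "G m t \<le> G (Suc m) t" by (auto simp: G_def indicator_def)
      qed
      show "G m \<in> borel_measurable lborel" for m
        using measI[of "1 / real (Suc m)" "real (Suc m)"] by (simp add: G_def[abs_def])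
    qed
    also have "\<dots> \<le> riemann_integral g"
    proof (rule SUP_least)
      fix m :: nat
      define d where "d = 1 / real (Suc m)"
      define N where "N = Suc m * Suc m"
      define t where "t i = real i * d" for i
      have d: "0 < d" by (simp add: d_def)
      have tmono: "0 \<le> t i" "t i \<le> t (Suc i)" for i using d by (auto simp: t_def field_simps)
      have step: "(\<integral>\<^sup>+x. g x * indicator {d..<t (Suc k)} x \<partial>lborel)
             \<le> (\<Sum>i<k. ennreal (t (Suc i) - t i) * (INF s\<in>{t i..t (Suc i)}. g s))" for k
      proof (induction k)
        case 0
        then show ?case by (simp add: t_def)
      next
        case (Suc k)
        have tp: "0 < t (Suc k)" using d by (simp add: t_def)
        have "(\<integral>\<^sup>+x. g x * indicator {d..<t (Suc (Suc k))} x \<partial>lborel)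
          \<le> (\<integral>\<^sup>+x. g x * indicator {d..<t (Suc k)} x
               + g x * indicator {t (Suc k)..<t (Suc (Suc k))} x \<partial>lborel)"
          by (intro nn_integral_mono) (auto simp: indicator_def)
        also have "\<dots> = (\<integral>\<^sup>+x. g x * indicator {d..<t (Suc k)} x \<partial>lborel)
               + (\<integral>\<^sup>+x. g x * indicator {t (Suc k)..<t (Suc (Suc k))} x \<partial>lborel)"
          by (rule nn_integral_add) (simp_all add: measI d tp)
        also have "(\<integral>\<^sup>+x. g x * indicator {t (Suc k)..<t (Suc (Suc k))} x \<partial>lborel)
            \<le> (\<integral>\<^sup>+x. g (t (Suc k)) * indicator {t (Suc k)..<t (Suc (Suc k))} x \<partial>lborel)"
          using tmono by (intro nn_integral_mono) (auto simp: indicator_def intro!: anti)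
        also have "\<dots> = g (t (Suc k)) * ennreal (t (Suc (Suc k)) - t (Suc k))"
          using tmono by (simp add: nn_integral_cmult_indicator)
        also have "t (Suc (Suc k)) - t (Suc k) = t (Suc k) - t k"
          by (simp add: t_def algebra_simps)
        also have "g (t (Suc k)) = (INF s\<in>{t k..t (Suc k)}. g s)"
          using tmono by (simp add: INF)
        finally show ?case using Suc by (simp add: mult.commute order_trans[OF _ add_right_mono])
      qed
      have tN: "real (Suc m) \<le> t (Suc N)"
      proof -
        have "t N = real (Suc m)" unfolding t_def N_def d_def of_nat_mult by simp
        then show ?thesis using tmono(2)[of N] by simp
      qed
      have "(\<integral>\<^sup>+x. G m x \<partial>lborel) \<le> (\<integral>\<^sup>+x. g x * indicator {d..<t (Suc N)} x \<partial>lborel)"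
        using tN by (intro nn_integral_mono) (auto simp: G_def d_def indicator_def)
      also have "\<dots> \<le> (\<Sum>i<N. ennreal (t (Suc i) - t i) * (INF s\<in>{t i..t (Suc i)}. g s))"
        by (rule step)
      also have "\<dots> \<le> riemann_integral g"
        unfolding riemann_integral_def
        using tmono by (intro SUP_upper2[of "(N, t)"]) (auto simp: t_def)
      finally show "(\<integral>\<^sup>+x. G m x \<partial>lborel) \<le> riemann_integral g" .
    qed
    finally show ?thesis using eq0 by simp
  qed
qed

definition valuation_integral :: "'a topology \<Rightarrow> ('a set \<Rightarrow> ennreal) \<Rightarrow> ('a \<Rightarrow> ennreal) \<Rightarrow> ennreal" where
  "valuation_integral X \<nu> f = riemann_integral (\<lambda>t. \<nu> {x \<in> topspace X. ennreal t < f x})"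

end

theory Submission
  imports Defs
begin

text \<open>
  Multiplying \<open>h\<close> by \<open>[1, \<infinity>]\<close> replaces \<open>h\<^sup>+\<close> by \<open>\<infinity>\<close>, because \<open>0 \<cdot>\<^sub>r \<infinity> = \<infinity>\<close>,
  and does not change the lower end point of \<open>F h\<close>. So the lower part of \<open>F\<close> is a functional \<open>G\<close>
  on lower semicontinuous maps \<open>f\<close>, evaluated on \<open>[f, \<infinity>]\<close>, and it is additive, homogeneous and
  Scott-continuous. The valuation has to be \<open>\<nu> U = G \<chi>\<^sub>U\<close>. A Darboux sum of \<open>\<integral> f d\<nu>\<close> is \<open>G\<close> of a
  step function below \<open>f\<close>, and the dyadic step functions increase to \<open>f\<close>.
\<close>

section \<open>Lower semicontinuous maps\<close>

text \<open>Continuity into \<open>[0, \<infinity>]\<close> with its Scott topology: the Scott-open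
  sets other than the whole space are the \<open>]t, \<infinity>]\<close>, the empty one being
  \<open>t = \<infinity>\<close>. Values outside \<open>topspace X\<close> do not matter.\<close>

definition lsc :: "'a topology \<Rightarrow> ('a \<Rightarrow> ennreal) \<Rightarrow> bool" where
  "lsc X f \<longleftrightarrow> (\<forall>t. openin X {x \<in> topspace X. t < f x})"

lemma lsc_cong: "(\<And>x. x \<in> topspace X \<Longrightarrow> f x = g x) \<Longrightarrow> lsc X f \<longleftrightarrow> lsc X g"
  unfolding lsc_def by (simp cong: conj_cong)

lemma lsc_zero: "lsc X (\<lambda>_. 0)"
  unfolding lsc_def by simp

lemma lsc_SUP:
  assumes "\<And>i. i \<in> I \<Longrightarrow> lsc X (f i)"
  shows "lsc X (\<lambda>x. SUP i\<in>I. f i x)"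
  unfolding lsc_def
proof
  fix t
  have "{x \<in> topspace X. t < (SUP i\<in>I. f i x)} = (\<Union>i\<in>I. {x \<in> topspace X. t < f i x})"
    by (auto simp: less_SUP_iff)
  then show "openin X {x \<in> topspace X. t < (SUP i\<in>I. f i x)}"
    using assms by (auto simp: lsc_def)
qed

text \<open>The bounds \<open>a \<le> t\<close> and \<open>b \<le> t\<close> force all three numbers
  to be finite and \<open>a\<close>, \<open>b\<close> to be positive, so that both can be lowered
  slightly without the sum falling to \<open>t\<close>.\<close>

lemma ennreal_less_add_split:
  fixes t a b :: ennreal
  assumes "t < a + b" "a \<le> t" "b \<le> t"
  obtains p q where "p < a" "q < b" "t < p + q"
proof -
  have fin: "t < top" "a < top" "b < top"
    using assms by (auto simp: less_top intro: le_less_trans less_le_trans[OF _ top_greatest])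
  obtain r where r: "0 \<le> r" "t = ennreal r" using fin(1) by (cases t) auto
  obtain x where x: "0 \<le> x" "a = ennreal x" using fin(2) by (cases a) auto
  obtain y where y: "0 \<le> y" "b = ennreal y" using fin(3) by (cases b) auto
  have "r < x + y" "x \<le> r" "y \<le> r"
    using assms r x y by (auto simp: ennreal_less_iff simp flip: ennreal_plus)
  \<comment> \<open>A third of the slack: after it is removed from each summand, the sum is still
    \<open>r + e\<close>.\<close>
  define e where "e = (x + y - r) / 3"
  have e: "0 < e" "e \<le> x" "e \<le> y" "r < (x - e) + (y - e)"
    using \<open>r < x + y\<close> \<open>x \<le> r\<close> \<open>y \<le> r\<close> by (auto simp: e_def field_simps)
  show ?thesis
  proof (rule that[of "ennreal (x - e)" "ennreal (y - e)"])
    show "ennreal (x - e) < a" "ennreal (y - e) < b"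
      using e x y by (auto simp: ennreal_less_iff)
    show "t < ennreal (x - e) + ennreal (y - e)"
      using e r by (simp add: ennreal_less_iff flip: ennreal_plus)
  qed
qed

lemma lsc_add:
  assumes "lsc X f" "lsc X g"
  shows "lsc X (\<lambda>x. f x + g x)"
  unfolding lsc_def
proof
  fix t :: ennreal
  let ?P = "{(p, q). t < p + q}"
  \<comment> \<open>The two sets in front of the union catch the points where one summand alone
    exceeds \<open>t\<close>; there the other may be \<open>0\<close>, and nothing lies strictly
    below \<open>0\<close>.\<close>
  have "{x \<in> topspace X. t < f x + g x} =
      {x \<in> topspace X. t < f x} \<union> {x \<in> topspace X. t < g x} \<union>
      (\<Union>(p, q)\<in>?P. {x \<in> topspace X. p < f x} \<inter> {x \<in> topspace X. q < g x})" (is "?L = ?R")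
  proof (intro equalityI subsetI)
    fix x assume x: "x \<in> ?L"
    show "x \<in> ?R"
    proof (cases "t < f x \<or> t < g x")
      case False
      then obtain p q where "p < f x" "q < g x" "t < p + q"
        using x ennreal_less_add_split[of t "f x" "g x"] by (auto simp: not_less)
      then show ?thesis using x by auto
    qed (use x in auto)
  next
    fix x assume "x \<in> ?R"
    then show "x \<in> ?L"
      by (auto intro: add_increasing add_increasing2 add_mono less_imp_le elim!: less_le_trans)
  qed
  then show "openin X ?L"
    using assms by (auto simp: lsc_def intro!: openin_Un openin_Union openin_Int)
qed

lemma lsc_cmult_indicator:
  assumes "openin X U"
  shows "lsc X (\<lambda>x. c * indicator U x)"
  unfolding lsc_def
proof
  fix t :: ennreal
  have "{x \<in> topspace X. t < c * indicator U x} = (if t < c then U else {})"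
    using openin_subset[OF assms] by (auto simp: indicator_def)
  then show "openin X {x \<in> topspace X. t < c * indicator U x}" using assms by simp
qed

lemma lsc_indicator: "openin X U \<Longrightarrow> lsc X (indicator U)"
  using lsc_cmult_indicator[of X U 1] by simp

lemma lsc_sum:
  assumes "\<And>i. i \<in> I \<Longrightarrow> lsc X (f i)"
  shows "lsc X (\<lambda>x. \<Sum>i\<in>I. f i x)"
  using assms by (induction I rule: infinite_finite_induct) (auto intro: lsc_zero lsc_add)

section \<open>Intervals unbounded above\<close>

lemma ivl_le_iff: "a \<sqsubseteq>\<^sub>I b \<longleftrightarrow> lower a \<le> lower b \<and> upper b \<le> upper a"
  unfolding ivl_le_def set_of_eq by (simp add: lower_le_upper)

definition up_ivl :: "ennreal \<Rightarrow> ivl" where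
  "up_ivl r = Interval (r, \<infinity>)"

lemma lower_up_ivl [simp]: "lower (up_ivl r) = r"
  by (simp add: up_ivl_def lower.rep_eq Interval_inverse)

lemma upper_up_ivl [simp]: "upper (up_ivl r) = \<infinity>"
  by (simp add: up_ivl_def upper.rep_eq Interval_inverse)

lemma up_ivl_add: "up_ivl r + up_ivl s = up_ivl (r + s)"
  by (simp add: interval_eq_iff)

text \<open>Here the convention for upper end points acts:
  \<open>\<infinity> \<cdot>\<^sub>r y\<close> is \<open>\<infinity>\<close> even for
  \<open>y = 0\<close>, so the product forgets the upper end point of \<open>i\<close>.\<close>

lemma up_ivl_mult: "up_ivl a \<otimes>\<^sub>I i = up_ivl (a * lower i)"
  by (simp add: interval_eq_iff lower_ivl_mult upper_ivl_mult mult_r_def ennreal_top_mult)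

text \<open>If every lower end point in \<open>D\<close> were at most \<open>t\<close>, then
  \<open>[t, upper s]\<close> would be an upper bound of \<open>D\<close>, and leastness of
  \<open>s\<close> would give \<open>lower s \<le> t\<close>. This is a genuine interval because
  \<open>t < lower s \<le> upper s\<close>.\<close>

lemma scott_open_lower_greater: "scott_open UNIV (\<sqsubseteq>\<^sub>I) {i. t < lower i}"
proof (rule scott_openI)
  fix D s assume s: "is_sup_in UNIV (\<sqsubseteq>\<^sub>I) D s" "s \<in> {i. t < lower i}"
  show "\<exists>i\<in>D. i \<in> {i. t < lower i}"
  proof (rule ccontr)
    assume *: "\<not> ?thesis"
    have "t \<le> upper s" using s(2) order_trans[OF less_imp_le lower_le_upper, of t s] by simp
    then have u: "lower (Interval (t, upper s)) = t" "upper (Interval (t, upper s)) = upper s"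
      by (simp_all add: lower.rep_eq upper.rep_eq Interval_inverse)
    have "\<forall>i\<in>D. i \<sqsubseteq>\<^sub>I Interval (t, upper s)"
      using * s(1) by (auto simp: is_sup_in_def ivl_le_iff u not_less)
    then have "s \<sqsubseteq>\<^sub>I Interval (t, upper s)" using s(1) by (auto simp: is_sup_in_def)
    then show False using s(2) by (simp add: ivl_le_iff u)
  qed
qed (auto simp: ivl_le_iff)

lemma lower_sup_ivl:
  assumes "is_sup_in UNIV (\<sqsubseteq>\<^sub>I) D s"
    and "directed_in UNIV (\<sqsubseteq>\<^sub>I) D"
  shows "lower s = (SUP i\<in>D. lower i)"
proof (rule antisym)
  show "(SUP i\<in>D. lower i) \<le> lower s"
    using assms(1) by (auto simp: is_sup_in_def ivl_le_iff intro: SUP_least)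
  show "lower s \<le> (SUP i\<in>D. lower i)"
  proof (rule ccontr)
    assume "\<not> ?thesis"
    \<comment> \<open>The Scott-open set of intervals whose lower end point exceeds the supremum
      contains \<open>s\<close>, hence meets \<open>D\<close>.\<close>
    then obtain i where "i \<in> D" "(SUP i\<in>D. lower i) < lower i"
      using scott_openD(3)[OF scott_open_lower_greater assms(2,1)] by (auto simp: not_le)
    then show False using SUP_upper[of i D lower] by simp
  qed
qed

lemma lsc_lower_LI:
  assumes "h \<in> LI X"
  shows "lsc X (\<lambda>x. lower (h x))"
proof -
  have "continuous_map X (scott_topology UNIV (\<sqsubseteq>\<^sub>I)) h" using assms by (simp add: LI_def)
  then have "openin X {x \<in> topspace X. h x \<in> {i. t < lower i}}" for t
    using scott_open_lower_greater unfolding continuous_map_def openin_scott_topology by blast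
  then show ?thesis by (simp add: lsc_def)
qed

text \<open>The map \<open>[f, \<infinity>]\<close>, restricted because elements of
  \<open>LI X\<close> are extensional.\<close>

definition up_map :: "'a topology \<Rightarrow> ('a \<Rightarrow> ennreal) \<Rightarrow> 'a \<Rightarrow> ivl" where
  "up_map X f = (\<lambda>x\<in>topspace X. up_ivl (f x))"

text \<open>By density, \<open>[r, \<infinity>]\<close> is the supremum of the chain of all
  \<open>[q, \<infinity>]\<close> with \<open>q < r\<close>; the chain is nonempty because
  \<open>r \<noteq> 0\<close>.\<close>

lemma scott_open_up_ivl:
  assumes U: "scott_open UNIV (\<sqsubseteq>\<^sub>I) U" and r: "up_ivl r \<in> U" and "r \<noteq> 0"
  obtains q where "q < r" "up_ivl q \<in> U"
proof -
  have "directed_in UNIV (\<sqsubseteq>\<^sub>I) (up_ivl ` {..<r})"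
    unfolding directed_in_def
  proof (intro conjI ballI)
    show "up_ivl ` {..<r} \<noteq> {}" using \<open>r \<noteq> 0\<close> not_gr_zero[of r] by blast
    fix a b assume "a \<in> up_ivl ` {..<r}" "b \<in> up_ivl ` {..<r}"
    then obtain p q where "p < r" "q < r" "a = up_ivl p" "b = up_ivl q" by auto
    then show "\<exists>c\<in>up_ivl ` {..<r}. a \<sqsubseteq>\<^sub>I c \<and> b \<sqsubseteq>\<^sub>I c"
      by (intro bexI[of _ "up_ivl (max p q)"]) (auto simp: ivl_le_iff)
  qed simp
  moreover have "is_sup_in UNIV (\<sqsubseteq>\<^sub>I) (up_ivl ` {..<r}) (up_ivl r)"
    by (auto simp: is_sup_in_def ivl_le_iff intro: dense_le)
  ultimately show thesis using scott_openD(3)[OF U _ _ r] that by auto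
qed

text \<open>An open set that contains \<open>[0, \<infinity>]\<close>, the least interval, is
  everything. Any other open \<open>U\<close> pulls back to the union of the sets where
  \<open>q < f x\<close>, over all \<open>q\<close> with \<open>[q, \<infinity>]\<close> in
  \<open>U\<close>.\<close>

lemma up_map_LI:
  assumes "lsc X f"
  shows "up_map X f \<in> LI X"
proof -
  have "openin X {x \<in> topspace X. up_map X f x \<in> U}" if U: "scott_open UNIV (\<sqsubseteq>\<^sub>I) U" for U
  proof (cases "up_ivl 0 \<in> U")
    case True
    then have "up_ivl r \<in> U" for r
      using scott_openD(2)[OF U, of "up_ivl 0" "up_ivl r"] by (simp add: ivl_le_iff)
    then have "{x \<in> topspace X. up_map X f x \<in> U} = topspace X" by (auto simp: up_map_def)
    then show ?thesis by simp
  next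
    case False
    have up: "up_ivl s \<in> U" if "up_ivl q \<in> U" "q < s" for q s
      using scott_openD(2)[OF U that(1), of "up_ivl s"] that(2) by (simp add: ivl_le_iff)
    have down: "\<exists>q. up_ivl q \<in> U \<and> q < r" if "up_ivl r \<in> U" for r
      using scott_open_up_ivl[OF U that] that False by metis
    have "{x \<in> topspace X. up_map X f x \<in> U} =
        (\<Union>q\<in>{q. up_ivl q \<in> U}. {x \<in> topspace X. q < f x})"
      using up down by (auto simp: up_map_def)
    then show ?thesis using assms by (auto simp: lsc_def)
  qed
  then show ?thesis
    by (auto simp: LI_def continuous_map_def openin_scott_topology topspace_scott_topology up_map_def)
qed

section \<open>The functional on lower semicontinuous maps\<close>

text \<open>The functional \<open>G\<close> of the overview, meant for \<open>f\<close> with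
  \<open>lsc X f\<close>, since then \<open>up_map X f\<close> lies in \<open>LI X\<close>.\<close>

definition lower_functional ::
  "'a topology \<Rightarrow> (('a \<Rightarrow> ivl) \<Rightarrow> ivl) \<Rightarrow> ('a \<Rightarrow> ennreal) \<Rightarrow> ennreal" where
  "lower_functional X F f = lower (F (up_map X f))"

lemma lower_functional_cong:
  "(\<And>x. x \<in> topspace X \<Longrightarrow> f x = g x) \<Longrightarrow> lower_functional X F f = lower_functional X F g"
  unfolding lower_functional_def up_map_def by (metis restrict_ext)

context
  fixes X :: "'a topology" and F :: "('a \<Rightarrow> ivl) \<Rightarrow> ivl"
  assumes F: "continuous_ivl_valuation X F"
begin

text \<open>Homogeneity for the scalar \<open>[1, \<infinity>]\<close>. Independence of the upper
  end points of \<open>h\<close> is immediate from this equation.\<close>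

lemma lower_eq_lower_functional:
  assumes "h \<in> LI X"
  shows "lower (F h) = lower_functional X F (\<lambda>x. lower (h x))"
proof -
  have "F (\<lambda>x\<in>topspace X. up_ivl 1 \<otimes>\<^sub>I h x) = up_ivl 1 \<otimes>\<^sub>I F h"
    using F assms by (simp add: continuous_ivl_valuation_def)
  then show ?thesis by (simp add: up_ivl_mult lower_functional_def up_map_def)
qed

text \<open>The scalar \<open>up_ivl a\<close> acts as \<open>a\<close> on lower end points and
  keeps upper end points at \<open>\<infinity>\<close>.\<close>

lemma lower_functional_cmult:
  assumes "lsc X f"
  shows "lower_functional X F (\<lambda>x. a * f x) = a * lower_functional X F f"
proof -
  have "F (\<lambda>x\<in>topspace X. up_ivl a \<otimes>\<^sub>I up_map X f x) = up_ivl a \<otimes>\<^sub>I F (up_map X f)"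
    using F up_map_LI[OF assms] by (simp add: continuous_ivl_valuation_def)
  moreover have "(\<lambda>x\<in>topspace X. up_ivl a \<otimes>\<^sub>I up_map X f x) = up_map X (\<lambda>x. a * f x)"
    by (auto simp: up_map_def up_ivl_mult)
  ultimately show ?thesis by (simp add: up_ivl_mult lower_functional_def)
qed

text \<open>Homogeneity for the scalar \<open>0\<close>, with \<open>0 * \<infinity> = 0\<close>.
  Additivity alone would still allow the value \<open>\<infinity>\<close>.\<close>

lemma lower_functional_zero: "lower_functional X F (\<lambda>_. 0) = 0"
  using lower_functional_cmult[OF lsc_zero, of 0] by simp

lemma lower_functional_add:
  assumes "lsc X f" "lsc X g"
  shows "lower_functional X F (\<lambda>x. f x + g x) = lower_functional X F f + lower_functional X F g"
proof -
  have "F (\<lambda>x\<in>topspace X. up_map X f x + up_map X g x) = F (up_map X f) + F (up_map X g)"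
    using F up_map_LI[OF assms(1)] up_map_LI[OF assms(2)]
    by (simp add: continuous_ivl_valuation_def)
  moreover have "(\<lambda>x\<in>topspace X. up_map X f x + up_map X g x) = up_map X (\<lambda>x. f x + g x)"
    by (auto simp: up_map_def up_ivl_add)
  ultimately show ?thesis by (simp add: lower_functional_def)
qed

lemma lower_functional_sum:
  assumes "\<And>i. i \<in> I \<Longrightarrow> lsc X (f i)"
  shows "lower_functional X F (\<lambda>x. \<Sum>i\<in>I. f i x) = (\<Sum>i\<in>I. lower_functional X F (f i))"
  using assms
  by (induction I rule: infinite_finite_induct)
    (simp_all add: lower_functional_zero lower_functional_add lsc_sum)

lemma lower_functional_mono:
  assumes "lsc X f" "lsc X g" "\<And>x. x \<in> topspace X \<Longrightarrow> f x \<le> g x"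
  shows "lower_functional X F f \<le> lower_functional X F g"
proof -
  have "LI_le X (up_map X f) (up_map X g)"
    using assms(3) by (simp add: LI_le_def up_map_def ivl_le_iff)
  then have "F (up_map X f) \<sqsubseteq>\<^sub>I F (up_map X g)"
    using F up_map_LI[OF assms(1)] up_map_LI[OF assms(2)]
    by (simp add: continuous_ivl_valuation_def scott_continuous_def)
  then show ?thesis by (simp add: lower_functional_def ivl_le_iff)
qed

text \<open>The map \<open>[sup f_i, \<infinity>]\<close> is the directed supremum of the
  \<open>[f_i, \<infinity>]\<close> in \<open>LI X\<close>. \<open>F\<close> preserves it, and the
  lower end point of a directed supremum of intervals is the supremum of the lower end
  points.\<close>

lemma lower_functional_SUP:
  assumes "I \<noteq> {}" and lsc: "\<And>i. i \<in> I \<Longrightarrow> lsc X (f i)"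
    and dir: "\<And>i j. i \<in> I \<Longrightarrow> j \<in> I \<Longrightarrow>
      \<exists>k\<in>I. \<forall>x\<in>topspace X. f i x \<le> f k x \<and> f j x \<le> f k x"
  shows "lower_functional X F (\<lambda>x. SUP i\<in>I. f i x) = (SUP i\<in>I. lower_functional X F (f i))"
proof -
  let ?D = "(\<lambda>i. up_map X (f i)) ` I" and ?s = "up_map X (\<lambda>x. SUP i\<in>I. f i x)"
  have scott: "scott_continuous (LI X) (LI_le X) UNIV (\<sqsubseteq>\<^sub>I) F"
    using F by (simp add: continuous_ivl_valuation_def)
  have D: "directed_in (LI X) (LI_le X) ?D"
    unfolding directed_in_def
  proof (intro conjI ballI)
    show "?D \<subseteq> LI X" using lsc up_map_LI by auto
    show "?D \<noteq> {}" using assms(1) by simp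
    fix u v assume "u \<in> ?D" "v \<in> ?D"
    then obtain i j where ij: "i \<in> I" "j \<in> I" "u = up_map X (f i)" "v = up_map X (f j)" by auto
    with dir obtain k where "k \<in> I" "\<forall>x\<in>topspace X. f i x \<le> f k x \<and> f j x \<le> f k x" by meson
    then show "\<exists>w\<in>?D. LI_le X u w \<and> LI_le X v w"
      using ij by (intro bexI[of _ "up_map X (f k)"]) (auto simp: LI_le_def up_map_def ivl_le_iff)
  qed
  moreover have "is_sup_in (LI X) (LI_le X) ?D ?s"
    unfolding is_sup_in_def
  proof (intro conjI ballI impI)
    show "?s \<in> LI X" by (intro up_map_LI lsc_SUP lsc)
  qed (auto simp: LI_le_def up_map_def ivl_le_iff intro: SUP_upper SUP_least)
  ultimately have "is_sup_in UNIV (\<sqsubseteq>\<^sub>I) (F ` ?D) (F ?s)"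
    using scott by (simp add: scott_continuous_def)
  moreover have "directed_in UNIV (\<sqsubseteq>\<^sub>I) (F ` ?D)"
    unfolding directed_in_def
  proof (intro conjI ballI)
    fix u v assume "u \<in> F ` ?D" "v \<in> F ` ?D"
    then obtain g h where gh: "g \<in> ?D" "h \<in> ?D" "u = F g" "v = F h" by auto
    with D obtain k where "k \<in> ?D" "LI_le X g k" "LI_le X h k"
      unfolding directed_in_def by meson
    moreover have "?D \<subseteq> LI X" using D by (simp add: directed_in_def)
    ultimately have "F g \<sqsubseteq>\<^sub>I F k" "F h \<sqsubseteq>\<^sub>I F k"
      using scott gh(1,2) unfolding scott_continuous_def by blast+
    with gh \<open>k \<in> ?D\<close> show "\<exists>w\<in>F ` ?D. u \<sqsubseteq>\<^sub>I w \<and> v \<sqsubseteq>\<^sub>I w" by blast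
  qed (use assms(1) in auto)
  ultimately show ?thesis
    by (simp add: lower_sup_ivl lower_functional_def image_image)
qed

end

section \<open>Step functions\<close>

text \<open>With \<open>y = f x\<close>, this is the function of \<open>x\<close> whose integral is
  a lower Darboux sum of \<open>\<integral> f d\<nu>\<close>. The threshold is the right end point
  \<open>t (Suc i)\<close> because an antitone integrand attains its infimum there.\<close>

definition step_fun :: "nat \<Rightarrow> (nat \<Rightarrow> real) \<Rightarrow> ennreal \<Rightarrow> ennreal" where
  "step_fun n t y = (\<Sum>i<n. ennreal (t (Suc i) - t i) * indicator {ennreal (t (Suc i))<..} y)"

lemma step_fun_le:
  assumes "t 0 = 0" "\<forall>i<n. t i \<le> t (Suc i)"
  shows "step_fun n t y \<le> y"
proof -
  \<comment> \<open>The induction also needs the bound \<open>t m\<close>, from the telescoping sum: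
    a new term appears only when \<open>y\<close> exceeds \<open>t (Suc m)\<close>. Nonnegativity of
    \<open>t m\<close> makes the telescoping valid in \<open>ennreal\<close>, where negative reals
    become \<open>0\<close>.\<close>
  have "0 \<le> t m \<and> step_fun m t y \<le> min y (ennreal (t m))" if "m \<le> n" for m
    using that
  proof (induction m)
    case 0
    then show ?case using assms(1) by (simp add: step_fun_def)
  next
    case (Suc m)
    then have IH: "0 \<le> t m" "step_fun m t y \<le> y" "step_fun m t y \<le> ennreal (t m)"
      and tm: "t m \<le> t (Suc m)"
      using assms(2) by auto
    have S: "step_fun (Suc m) t y =
        step_fun m t y + ennreal (t (Suc m) - t m) * indicator {ennreal (t (Suc m))<..} y"
      by (simp add: step_fun_def)
    have "step_fun m t y + ennreal (t (Suc m) - t m) \<le> ennreal (t m) + ennreal (t (Suc m) - t m)"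
      using IH(3) by (rule add_right_mono)
    also have "\<dots> = ennreal (t (Suc m))" using IH(1) tm by (simp flip: ennreal_plus)
    finally have "step_fun m t y + ennreal (t (Suc m) - t m) \<le> ennreal (t (Suc m))" .
    moreover have "step_fun m t y \<le> ennreal (t (Suc m))"
      using IH(3) tm by (meson ennreal_leI order_trans)
    ultimately show ?case
      using IH(1,2) tm by (auto simp: S indicator_def)
  qed
  then show ?thesis by auto
qed

section \<open>Dyadic approximation from below\<close>

abbreviation dyadic :: "nat \<Rightarrow> nat \<Rightarrow> real" where
  "dyadic n i \<equiv> real i / 2 ^ n"

text \<open>The subdivision cuts \<open>[0, n]\<close> into pieces of length
  \<open>1 / 2 ^ n\<close>, so range and precision grow together.\<close>

abbreviation dyadic_step :: "nat \<Rightarrow> ennreal \<Rightarrow> ennreal" where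
  "dyadic_step n \<equiv> step_fun (n * 2 ^ n) (dyadic n)"

lemma dyadic_step_eq:
  "dyadic_step n y = (\<Sum>i<n * 2 ^ n. ennreal (1 / 2 ^ n) * indicator {ennreal (dyadic n (Suc i))<..} y)"
  unfolding step_fun_def by (simp add: field_simps flip: diff_divide_distrib)

lemma sum_lessThan_double:
  fixes f :: "nat \<Rightarrow> 'a::comm_monoid_add"
  shows "(\<Sum>j<2 * m. f j) = (\<Sum>i<m. f (2 * i) + f (Suc (2 * i)))"
  by (induction m) (simp_all add: ac_simps)

text \<open>Each piece splits into two halves at the next level. One half keeps the threshold and
  the other has a smaller one, so both terms are present whenever the old one is; extending the
  range only adds nonnegative terms.\<close>

lemma incseq_dyadic_step: "incseq (\<lambda>n. dyadic_step n y)"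
proof (rule incseq_SucI)
  fix n
  let ?f = "\<lambda>n i. ennreal (1 / 2 ^ n) * indicator {ennreal (dyadic n (Suc i))<..} y"
  have half: "ennreal (1 / 2 ^ n) = ennreal (1 / 2 ^ Suc n) + ennreal (1 / 2 ^ Suc n)"
    by (simp add: field_simps flip: ennreal_plus)
  have *: "?f n i \<le> ?f (Suc n) (2 * i) + ?f (Suc n) (Suc (2 * i))" for i
  proof (cases "ennreal (dyadic n (Suc i)) < y")
    case True
    have "dyadic (Suc n) (Suc (2 * i)) \<le> dyadic n (Suc i)"
      "dyadic (Suc n) (Suc (Suc (2 * i))) \<le> dyadic n (Suc i)"
      by (simp_all add: field_simps)
    then have "ennreal (dyadic (Suc n) (Suc (2 * i))) < y"
      "ennreal (dyadic (Suc n) (Suc (Suc (2 * i)))) < y"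
      using True by (meson ennreal_leI le_less_trans)+
    then show ?thesis using True by (simp add: half del: power_Suc)
  qed simp
  have "dyadic_step n y \<le> (\<Sum>i<n * 2 ^ n. ?f (Suc n) (2 * i) + ?f (Suc n) (Suc (2 * i)))"
    unfolding dyadic_step_eq by (intro sum_mono *)
  also have "\<dots> = (\<Sum>j<2 * (n * 2 ^ n). ?f (Suc n) j)"
    by (rule sum_lessThan_double[symmetric])
  also have "\<dots> \<le> dyadic_step (Suc n) y"
    unfolding dyadic_step_eq by (intro sum_mono2) auto
  finally show "dyadic_step n y \<le> dyadic_step (Suc n) y" .
qed

lemma SUP_dyadic_step: "(SUP n. dyadic_step n y) = y"
proof (rule antisym)
  show "(SUP n. dyadic_step n y) \<le> y"
    by (intro SUP_least step_fun_le) (auto simp: field_simps)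
  show "y \<le> (SUP n. dyadic_step n y)"
  proof (rule dense_le)
    fix z assume "z < y"
    \<comment> \<open>Interposing \<open>w\<close> gives a finite bound below \<open>y\<close> even
      when \<open>y = \<infinity>\<close>.\<close>
    then obtain w where w: "z < w" "w < y" using dense by blast
    obtain c where c: "0 \<le> c" "z = ennreal c" using w by (cases z) auto
    obtain d where d: "0 \<le> d" "w = ennreal d" using w by (cases w) auto
    have "c < d" using w c d by (simp add: ennreal_less_iff)
    obtain p where p: "c + 1 < real p" using reals_Archimedean2 by blast
    obtain q where q: "(1 / 2) ^ q < d - c"
      using real_arch_pow_inv[of "d - c" "1 / 2"] \<open>c < d\<close> by auto
    \<comment> \<open>Large enough that the mesh is below \<open>d - c\<close> and that
      \<open>c + 1 \<le> n\<close>. Then \<open>k / 2 ^ n\<close> is a grid point in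
      \<open>[0, n]\<close> that is at least \<open>c\<close> and below \<open>d\<close>, and the
      first \<open>k\<close> terms, all present, add up to it.\<close>
    define n where "n = max p q"
    define k where "k = nat \<lfloor>c * 2 ^ n\<rfloor> + 1"
    have "(1 / 2 :: real) ^ n \<le> (1 / 2) ^ q"
      by (rule power_decreasing) (auto simp: n_def)
    then have n: "c + 1 / 2 ^ n < d" using q by (simp add: power_one_over)
    have k: "c * 2 ^ n \<le> real k" "real k \<le> c * 2 ^ n + 1"
      using c(1) by (simp_all add: k_def) linarith+
    have kn: "k \<le> n * 2 ^ n"
    proof -
      have "real k \<le> c * 2 ^ n + 2 ^ n" using k(2) one_le_power[of "2 :: real" n] by linarith
      also have "\<dots> = (c + 1) * 2 ^ n" by (simp add: algebra_simps)
      also have "\<dots> \<le> real n * 2 ^ n"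
        using p by (intro mult_right_mono) (auto simp: n_def)
      also have "\<dots> = real (n * 2 ^ n)" by simp
      finally show ?thesis using of_nat_le_iff by blast
    qed
    have thr: "ennreal (dyadic n (Suc i)) < y" if "i < k" for i
    proof -
      have "dyadic n (Suc i) \<le> dyadic n k" using that by (intro divide_right_mono) auto
      also have "\<dots> \<le> c + 1 / 2 ^ n" using k(2) by (simp add: field_simps)
      also have "\<dots> < d" by (rule n)
      finally have "ennreal (dyadic n (Suc i)) < w" using d by (simp add: ennreal_less_iff)
      then show ?thesis using w by simp
    qed
    have "z \<le> ennreal (dyadic n k)" using c k(1) by (auto simp: field_simps intro!: ennreal_leI)
    also have "\<dots> = (\<Sum>i<k. ennreal (1 / 2 ^ n))"
      by (simp add: ennreal_of_nat_eq_real_of_nat flip: ennreal_mult)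
    also have "\<dots> = (\<Sum>i<k. ennreal (1 / 2 ^ n) * indicator {ennreal (dyadic n (Suc i))<..} y)"
      using thr by (intro sum.cong) auto
    also have "\<dots> \<le> dyadic_step n y"
      unfolding dyadic_step_eq using kn by (intro sum_mono2) auto
    also have "\<dots> \<le> (SUP n. dyadic_step n y)" by (rule SUP_upper) simp
    finally show "z \<le> (SUP n. dyadic_step n y)" .
  qed
qed

section \<open>The representing valuation\<close>

text \<open>Restricted to the open sets, as \<open>continuous_valuation\<close> demands; this makes
  uniqueness an equality of functions.\<close>

definition lower_valuation ::
  "'a topology \<Rightarrow> (('a \<Rightarrow> ivl) \<Rightarrow> ivl) \<Rightarrow> 'a set \<Rightarrow> ennreal" where
  "lower_valuation X F = (\<lambda>U\<in>{U. openin X U}. lower_functional X F (indicator U))"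

lemma is_sup_in_openin_Union:
  assumes "directed_in {U. openin X U} (\<subseteq>) D" "is_sup_in {U. openin X U} (\<subseteq>) D S"
  shows "S = \<Union>D"
proof
  have "openin X (\<Union>D)" using assms(1) by (auto simp: directed_in_def)
  then show "S \<subseteq> \<Union>D" using assms(2) by (auto simp: is_sup_in_def)
  show "\<Union>D \<subseteq> S" using assms(2) by (auto simp: is_sup_in_def)
qed

text \<open>The properties of \<open>G\<close> transfer through indicators: that of a directed union
  is the supremum of the indicators, and those of \<open>U \<union> V\<close> and
  \<open>U \<inter> V\<close> have the same sum as those of \<open>U\<close> and
  \<open>V\<close>.\<close>

lemma continuous_valuation_lower_valuation:
  assumes F: "continuous_ivl_valuation X F"
  shows "continuous_valuation X (lower_valuation X F)"
  unfolding continuous_valuation_def scott_continuous_def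
proof (intro conjI ballI allI impI)
  let ?\<nu> = "lower_valuation X F"
  show mono: "?\<nu> U \<le> ?\<nu> V"
    if "U \<in> {U. openin X U}" "V \<in> {U. openin X U}" "U \<subseteq> V" for U V
    using that
    by (auto simp: lower_valuation_def indicator_def
        intro!: lower_functional_mono[OF F] lsc_indicator)
  show "is_sup_in UNIV (\<le>) (?\<nu> ` D) (?\<nu> S)"
    if D: "directed_in {U. openin X U} (\<subseteq>) D" and S: "is_sup_in {U. openin X U} (\<subseteq>) D S" for D S
  proof -
    have S_eq: "S = \<Union>D" by (rule is_sup_in_openin_Union[OF D S])
    have opn: "openin X U" if "U \<in> D" for U using that D by (auto simp: directed_in_def)
    have ne: "D \<noteq> {}" using D by (simp add: directed_in_def)
    have "indicator S x = (SUP U\<in>D. indicator U x :: ennreal)" for x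
    proof (cases "x \<in> S")
      case True
      then obtain U where "U \<in> D" "x \<in> U" using S_eq by auto
      then show ?thesis using True
        by (intro antisym SUP_upper2[of U] SUP_least) (auto simp: indicator_def)
    next
      case False
      then show ?thesis using ne by (auto simp: S_eq indicator_def intro!: SUP_eqI[symmetric])
    qed
    then have "lower_functional X F (indicator S) =
        lower_functional X F (\<lambda>x. SUP U\<in>D. indicator U x)" by presburger
    also have "\<dots> = (SUP U\<in>D. lower_functional X F (indicator U))"
    proof (rule lower_functional_SUP[OF F ne])
      fix U V assume "U \<in> D" "V \<in> D"
      then obtain W where "W \<in> D" "U \<subseteq> W" "V \<subseteq> W" using D unfolding directed_in_def by meson
      then show "\<exists>W\<in>D. \<forall>x\<in>topspace X.
          indicator U x \<le> (indicator W x :: ennreal) \<and> indicator V x \<le> (indicator W x :: ennreal)"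
        by (intro bexI[of _ W]) (auto simp: indicator_def)
    qed (use opn lsc_indicator in auto)
    finally have "?\<nu> S = (SUP U\<in>D. ?\<nu> U)"
      using opn S by (simp add: lower_valuation_def is_sup_in_def)
    then show ?thesis by (auto simp: is_sup_in_def intro: SUP_upper SUP_least)
  qed
  show "?\<nu> {} = 0"
    using lower_functional_zero[OF F] by (simp add: lower_valuation_def indicator_def[abs_def])
  show "?\<nu> (U \<union> V) + ?\<nu> (U \<inter> V) = ?\<nu> U + ?\<nu> V" if "openin X U" "openin X V" for U V
  proof -
    have "indicator (U \<union> V) x + indicator (U \<inter> V) x = indicator U x + (indicator V x :: ennreal)"
      for x by (auto simp: indicator_def)
    then show ?thesis
      using that
      by (simp add: lower_valuation_def openin_Un openin_Int lsc_indicator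
          flip: lower_functional_add[OF F])
  qed
qed (simp_all add: lower_valuation_def)

lemma valuation_integral_lower_valuation:
  assumes F: "continuous_ivl_valuation X F" and f: "lsc X f"
  shows "valuation_integral X (lower_valuation X F) f = lower_functional X F f"
proof -
  define g where "g t = lower_valuation X F {x \<in> topspace X. ennreal t < f x}" for t
  have opn: "openin X {x \<in> topspace X. ennreal t < f x}" for t using f by (simp add: lsc_def)
  \<comment> \<open>This holds on all reals: for negative arguments \<open>ennreal\<close> gives
    \<open>0\<close>.\<close>
  have anti: "g t \<le> g s" if "s \<le> t" for s t
    using opn that unfolding g_def lower_valuation_def
    by (auto intro!: lower_functional_mono[OF F] lsc_indicator
        simp: indicator_def dest: le_less_trans[OF ennreal_leI])
  have INF: "(INF s\<in>{a..b}. g s) = g b" if "a \<le> b" for a b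
    using that by (intro antisym INF_greatest INF_lower anti) auto
  \<comment> \<open>Each infimum is the value at the right end point, and homogeneity and additivity
    then move the finite sum inside \<open>G\<close>.\<close>
  have sum: "(\<Sum>i<n. ennreal (t (Suc i) - t i) * (INF s\<in>{t i..t (Suc i)}. g s)) =
      lower_functional X F (\<lambda>x. step_fun n t (f x))" and lsc: "lsc X (\<lambda>x. step_fun n t (f x))"
    if "\<forall>i<n. t i \<le> t (Suc i)" for n t
  proof -
    let ?U = "\<lambda>i. {x \<in> topspace X. ennreal (t (Suc i)) < f x}"
    have step: "step_fun n t (f x) = (\<Sum>i<n. ennreal (t (Suc i) - t i) * indicator (?U i) x)"
      if "x \<in> topspace X" for x
      using that by (simp add: step_fun_def indicator_def)
    have "(\<Sum>i<n. ennreal (t (Suc i) - t i) * (INF s\<in>{t i..t (Suc i)}. g s)) =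
        (\<Sum>i<n. ennreal (t (Suc i) - t i) * g (t (Suc i)))"
      using that by (intro sum.cong) (simp_all add: INF)
    also have "\<dots> =
        (\<Sum>i<n. ennreal (t (Suc i) - t i) * lower_functional X F (indicator (?U i)))"
      using opn by (simp add: g_def lower_valuation_def)
    also have "\<dots> =
        (\<Sum>i<n. lower_functional X F (\<lambda>x. ennreal (t (Suc i) - t i) * indicator (?U i) x))"
      by (simp only: lower_functional_cmult[OF F lsc_indicator[OF opn]])
    also have "\<dots> = lower_functional X F
        (\<lambda>x. \<Sum>i<n. ennreal (t (Suc i) - t i) * indicator (?U i) x)"
      by (rule lower_functional_sum[OF F, symmetric]) (rule lsc_cmult_indicator[OF opn])
    finally show "(\<Sum>i<n. ennreal (t (Suc i) - t i) * (INF s\<in>{t i..t (Suc i)}. g s)) =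
        lower_functional X F (\<lambda>x. step_fun n t (f x))"
      using step by (simp cong: lower_functional_cong)
    have "lsc X (\<lambda>x. step_fun n t (f x)) \<longleftrightarrow>
        lsc X (\<lambda>x. \<Sum>i<n. ennreal (t (Suc i) - t i) * indicator (?U i) x)"
      by (rule lsc_cong) (rule step)
    moreover have "lsc X (\<lambda>x. \<Sum>i<n. ennreal (t (Suc i) - t i) * indicator (?U i) x)"
      by (rule lsc_sum) (rule lsc_cmult_indicator[OF opn])
    ultimately show "lsc X (\<lambda>x. step_fun n t (f x))" by (rule iffD2)
  qed
  have "riemann_integral g = lower_functional X F f"
  proof (rule antisym)
    show "riemann_integral g \<le> lower_functional X F f"
      unfolding riemann_integral_def
    proof (rule SUP_least, clarify)
      fix n :: nat and t :: "nat \<Rightarrow> real"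
      assume t: "t 0 = 0" "\<forall>i<n. t i \<le> t (Suc i)"
      show "(\<Sum>i<n. ennreal (t (Suc i) - t i) * (INF s\<in>{t i..t (Suc i)}. g s))
          \<le> lower_functional X F f"
        unfolding sum[OF t(2)]
        by (intro lower_functional_mono[OF F] lsc t f step_fun_le)
    qed
    have dy: "\<forall>i<m. dyadic n i \<le> dyadic n (Suc i)" for m n by (simp add: divide_right_mono)
    \<comment> \<open>For this inequality the dyadic subdivisions suffice: continuity of
      \<open>G\<close> makes \<open>G f\<close> the supremum of their Darboux sums.\<close>
    have "lower_functional X F f = lower_functional X F (\<lambda>x. SUP n. dyadic_step n (f x))"
      by (simp only: SUP_dyadic_step)
    also have "\<dots> = (SUP n. lower_functional X F (\<lambda>x. dyadic_step n (f x)))"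
    proof (rule lower_functional_SUP[OF F])
      show "\<exists>k\<in>UNIV. \<forall>x\<in>topspace X.
          dyadic_step i (f x) \<le> dyadic_step k (f x) \<and> dyadic_step j (f x) \<le> dyadic_step k (f x)"
        for i j
        by (intro bexI[of _ "max i j"] ballI conjI incseqD[OF incseq_dyadic_step]) auto
    qed (use lsc dy in auto)
    also have "\<dots> \<le> riemann_integral g"
    proof (rule SUP_least)
      fix n
      show "lower_functional X F (\<lambda>x. dyadic_step n (f x)) \<le> riemann_integral g"
        unfolding riemann_integral_def sum[OF dy, symmetric]
        using dy by (intro SUP_upper2[of "(n * 2 ^ n, dyadic n)"]) auto
    qed
    finally show "lower_functional X F f \<le> riemann_integral g" .
  qed
  then show ?thesis by (simp add: valuation_integral_def g_def[abs_def])
qed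

text \<open>The superlevel sets are \<open>U\<close> below level \<open>1\<close> and empty from
  there on. Hence integrals of indicators determine the valuation, which gives uniqueness.\<close>

lemma valuation_integral_indicator:
  assumes \<nu>: "continuous_valuation X \<nu>" and U: "openin X U"
    and f: "\<And>x. x \<in> topspace X \<Longrightarrow> f x = indicator U x"
  shows "valuation_integral X \<nu> f = \<nu> U"
proof -
  have g: "\<nu> {x \<in> topspace X. ennreal t < f x} = (if t < 1 then \<nu> U else 0)" for t
  proof -
    have "{x \<in> topspace X. ennreal t < f x} = (if t < 1 then U else {})"
      using openin_subset[OF U] f
      by (auto simp: indicator_def split: if_splits split_of_bool_asm)
    then show ?thesis using \<nu> by (simp add: continuous_valuation_def)
  qed
  have "valuation_integral X \<nu> f = riemann_integral (\<lambda>t. if t < 1 then \<nu> U else 0)"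
    by (simp add: valuation_integral_def g)
  also have "\<dots> = (\<integral>\<^sup>+t\<in>{0::real..}. (if t < 1 then \<nu> U else 0) \<partial>lborel)"
    by (rule riemann_integral_eq_nn_integral) (auto simp: monotone_on_def)
  also have "\<dots> = (\<integral>\<^sup>+t. \<nu> U * indicator {0..<1::real} t \<partial>lborel)"
    by (intro nn_integral_cong) (auto simp: indicator_def)
  also have "\<dots> = \<nu> U" by (simp add: nn_integral_cmult_indicator)
  finally show ?thesis .
qed

theorem lemma6p2:
  fixes X :: "'a topology" and F :: "('a \<Rightarrow> ivl) \<Rightarrow> ivl"
  assumes "continuous_ivl_valuation X F"
  shows "(\<forall>h\<in>LI X. \<forall>h'\<in>LI X. (\<forall>x\<in>topspace X. lower (h x) = lower (h' x)) \<longrightarrow>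
            lower (F h) = lower (F h')) \<and>
         (\<exists>!\<nu>. continuous_valuation X \<nu> \<and>
            (\<forall>h\<in>LI X. lower (F h) = valuation_integral X \<nu> (\<lambda>x. lower (h x))))"
proof (intro conjI ballI impI ex1I[of _ "lower_valuation X F"])
  fix h h' assume "h \<in> LI X" "h' \<in> LI X" "\<forall>x\<in>topspace X. lower (h x) = lower (h' x)"
  then show "lower (F h) = lower (F h')"
    by (simp add: lower_eq_lower_functional[OF assms] cong: lower_functional_cong)
next
  show "continuous_valuation X (lower_valuation X F)"
    by (rule continuous_valuation_lower_valuation[OF assms])
next
  fix h assume "h \<in> LI X"
  then show "lower (F h) = valuation_integral X (lower_valuation X F) (\<lambda>x. lower (h x))"
    by (simp add: lower_eq_lower_functional[OF assms] lsc_lower_LI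
        valuation_integral_lower_valuation[OF assms])
next
  fix \<nu>
  assume "continuous_valuation X \<nu> \<and>
      (\<forall>h\<in>LI X. lower (F h) = valuation_integral X \<nu> (\<lambda>x. lower (h x)))"
  then have \<nu>: "continuous_valuation X \<nu>"
    and eq: "\<And>h. h \<in> LI X \<Longrightarrow> lower (F h) = valuation_integral X \<nu> (\<lambda>x. lower (h x))" by auto
  show "\<nu> = lower_valuation X F"
  proof (rule extensionalityI[of _ "{U. openin X U}"])
    show "\<nu> \<in> extensional {U. openin X U}" using \<nu> by (simp add: continuous_valuation_def)
    show "lower_valuation X F \<in> extensional {U. openin X U}" by (simp add: lower_valuation_def)
    fix U assume "U \<in> {U. openin X U}"
    then have U: "openin X U" by simp
    \<comment> \<open>The test map \<open>[\<chi>_U, \<infinity>]\<close> lies in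
      \<open>LI X\<close> because \<open>U\<close> is open.\<close>
    have "\<nu> U = valuation_integral X \<nu> (\<lambda>x. lower (up_map X (indicator U) x))"
      by (rule valuation_integral_indicator[symmetric, OF \<nu> U]) (simp add: up_map_def)
    also have "\<dots> = lower_functional X F (indicator U)"
      using eq[OF up_map_LI[OF lsc_indicator[OF U]]] by (simp add: lower_functional_def)
    also have "\<dots> = lower_valuation X F U" using U by (simp add: lower_valuation_def)
    finally show "\<nu> U = lower_valuation X F U" .
  qed
qed

end
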